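(* Let $n\ge 2$, let $V=(v_1,\dots,v_n)\in[0,1]^n$, let $\overline{v}=\max_i v_i$ and $\underline{v}=\min_i v_i$, and let $\Gamma=\Gamma_V$ be the $n\times n$ matrix with $\gamma_{ii}=1-v_i$ for each $i\in[n]$ and $\gamma_{ij}=v_i$ for all $j\ne i$. Then for any $n$-player linear congestion game $\mathcal{G}$, the linear congestion game with altruistic social context $(\mathcal{G},\Gamma)$ satisfies $$\mathsf{PoA}(\mathcal{G},\Gamma)\le\frac{2-\underline{v}}{1-\overline{v}}\quad\text{when }\overline{v}\in[1/2,1],$$ $$\mathsf{PoA}(\mathcal{G},\Gamma)\le\frac{5+2\overline{v}-3\underline{v}}{2-\overline{v}}\quad\text{when }\overline{v}\in[0,1/2],$$ where for $\overline{v}=1$ the first bound is understood as $+\infty$ (no constraint).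
   Context: Linear congestion game: a set of players $[n]=\{1,\dots,n\}$, $n\ge 2$, a finite set $E$ of resources, for each player $i$ a non-empty set $S_i\subseteq 2^E$ of strategies (each strategy is a non-empty subset of $E$), and for each $e\in E$ a latency function $\ell_e(x)=\alpha_e x+\beta_e$ with $\alpha_e,\beta_e\ge 0$. A strategy profile is $S=(s_1,\dots,s_n)$ with $s_i\in S_i$. The congestion of $e$ in $S$ is $n_e(S)=|\{j\in[n]:e\in s_j\}|$, and the cost of player $i$ in the underlying game is $c_i(S)=\sum_{e\in s_i}(\alpha_e n_e(S)+\beta_e)$. For $t\in S_i$, $S_{-i}\diamond t$ denotes the profile obtained from $S$ by replacing $s_i$ with $t$. A linear congestion game with altruistic social context is a pair $(\mathcal{G},\Gamma)$ where $\mathcal{G}$ is a linear congestion game with $n$ players and $\Gamma=(\gamma_{ij})\in\mathbb{R}^{n\times n}$ has non-negative entries; players and strategies are those of $\mathcal{G}$, but the cost of player $i$ in $S$ is $\widehat{c}_i(S)=\sum_{j\in[n]}\gamma_{ij}\,c_j(S)$. A pure Nash equilibrium of $(\mathcal{G},\Gamma)$ is a profile $S$ with $\widehat{c}_i(S)\le\widehat{c}_i(S_{-i}\diamond t)$ for every player $i$ and every $t\in S_i$. The social function is $\mathsf{SUM}(S)=\sum_{i\in[n]}c_i(S)$ (sum of the costs in the underlying game), and $S^*$ is a profile minimizing it. The price of anarchy $\mathsf{PoA}(\mathcal{G},\Gamma)$ is the maximum of $\mathsf{SUM}(S)/\mathsf{SUM}(S^* )$ over pure Nash equilibria $S$ of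 $(\mathcal{G},\Gamma)$; the bound $\mathsf{PoA}\le\rho$ means $\mathsf{SUM}(S)\le\rho\,\mathsf{SUM}(S^* )$ for every pure Nash equilibrium $S$. *)

theory Defs
  imports "HOL-Analysis.Analysis"
begin

text \<open>The latency of resource \<open>e\<close> is \<open>x \<mapsto> slope e * x + offset e\<close>; the players are \<open>1, \<dots>, num_players\<close>.\<close>

record 'e congestion_game =
  num_players :: nat
  resources :: "'e set"
  strategies :: "nat \<Rightarrow> 'e set set"
  slope :: "'e \<Rightarrow> real"
  offset :: "'e \<Rightarrow> real"

definition players :: "'e congestion_game \<Rightarrow> nat set" where
  "players G = {1..num_players G}"

definition linear_congestion_game :: "'e congestion_game \<Rightarrow> bool" where
  "linear_congestion_game G \<longleftrightarrow>
     2 \<le> num_players G \<and>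
     finite (resources G) \<and>
     (\<forall>i\<in>players G. strategies G i \<noteq> {} \<and>
        (\<forall>s\<in>strategies G i. s \<noteq> {} \<and> s \<subseteq> resources G)) \<and>
     (\<forall>e\<in>resources G. 0 \<le> slope G e \<and> 0 \<le> offset G e)"

text \<open>Profiles are extensional functions, so a profile is determined by its values on the players
  and there are only finitely many profiles.\<close>

definition profiles :: "'e congestion_game \<Rightarrow> (nat \<Rightarrow> 'e set) set" where
  "profiles G = PiE (players G) (strategies G)"

definition congestion :: "'e congestion_game \<Rightarrow> (nat \<Rightarrow> 'e set) \<Rightarrow> 'e \<Rightarrow> nat" where
  "congestion G S e = card {j\<in>players G. e \<in> S j}"

definition cost :: "'e congestion_game \<Rightarrow> nat \<Rightarrow> (nat \<Rightarrow> 'e set) \<Rightarrow> real" where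
  "cost G i S = (\<Sum>e\<in>S i. slope G e * real (congestion G S e) + offset G e)"

text \<open>A social context is a matrix given as a function; only its entries at players matter.\<close>

definition altruistic_cost ::
  "'e congestion_game \<Rightarrow> (nat \<Rightarrow> nat \<Rightarrow> real) \<Rightarrow> nat \<Rightarrow> (nat \<Rightarrow> 'e set) \<Rightarrow> real" where
  "altruistic_cost G \<Gamma> i S = (\<Sum>j\<in>players G. \<Gamma> i j * cost G j S)"

definition pure_nash ::
  "'e congestion_game \<Rightarrow> (nat \<Rightarrow> nat \<Rightarrow> real) \<Rightarrow> (nat \<Rightarrow> 'e set) \<Rightarrow> bool" where
  "pure_nash G \<Gamma> S \<longleftrightarrow>
     S \<in> profiles G \<and>
     (\<forall>i\<in>players G. \<forall>t\<in>strategies G i.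
        altruistic_cost G \<Gamma> i S \<le> altruistic_cost G \<Gamma> i (S(i := t)))"

definition social_cost :: "'e congestion_game \<Rightarrow> (nat \<Rightarrow> 'e set) \<Rightarrow> real" where
  "social_cost G S = (\<Sum>i\<in>players G. cost G i S)"

definition optimal_cost :: "'e congestion_game \<Rightarrow> real" where
  "optimal_cost G = Min (social_cost G ` profiles G)"

text \<open>Quotients of extended reals satisfy \<open>0 / 0 = 0\<close> and \<open>x / 0 = \<infinity>\<close> for \<open>x > 0\<close>, so the quotient is
  at most a real \<open>\<rho> \<ge> 0\<close> iff the equilibrium cost is at most \<open>\<rho>\<close> times the optimal cost, even if the
  latter is \<open>0\<close>; see \<open>price_of_anarchy_le_iff\<close>.\<close>

definition price_of_anarchy ::
  "'e congestion_game \<Rightarrow> (nat \<Rightarrow> nat \<Rightarrow> real) \<Rightarrow> ereal" where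
  "price_of_anarchy G \<Gamma> =
     (SUP S\<in>{S. pure_nash G \<Gamma> S}. ereal (social_cost G S) / ereal (optimal_cost G))"

definition context_of :: "(nat \<Rightarrow> real) \<Rightarrow> nat \<Rightarrow> nat \<Rightarrow> real" where
  "context_of v i j = (if j = i then 1 - v i else v i)"

lemma finite_profiles:
  assumes "linear_congestion_game G"
  shows "finite (profiles G)"
proof -
  have "finite (strategies G i)" if "i \<in> players G" for i
  proof (rule finite_subset)
    show "strategies G i \<subseteq> Pow (resources G)"
      using assms that by (auto simp: linear_congestion_game_def)
    show "finite (Pow (resources G))"
      using assms by (simp add: linear_congestion_game_def)
  qed
  then show ?thesis
    unfolding profiles_def by (intro finite_PiE) (auto simp: players_def)
qed

lemma profiles_nonempty:
  assumes "linear_congestion_game G"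
  shows "profiles G \<noteq> {}"
  using assms by (auto simp: profiles_def PiE_eq_empty_iff linear_congestion_game_def)

lemma cost_nonneg:
  assumes "linear_congestion_game G" "S \<in> profiles G" "i \<in> players G"
  shows "0 \<le> cost G i S"
proof -
  have "S i \<in> strategies G i"
    using assms by (auto simp: profiles_def)
  then have "S i \<subseteq> resources G"
    using assms by (auto simp: linear_congestion_game_def)
  then show ?thesis
    using assms unfolding cost_def linear_congestion_game_def
    by (intro sum_nonneg add_nonneg_nonneg mult_nonneg_nonneg) auto
qed

lemma social_cost_nonneg:
  assumes "linear_congestion_game G" "S \<in> profiles G"
  shows "0 \<le> social_cost G S"
  unfolding social_cost_def using assms by (intro sum_nonneg cost_nonneg)

lemma optimal_cost_nonneg:
  assumes "linear_congestion_game G"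
  shows "0 \<le> optimal_cost G"
  unfolding optimal_cost_def
  using finite_profiles[OF assms] profiles_nonempty[OF assms] social_cost_nonneg[OF assms]
  by (subst Min_ge_iff) auto

lemma price_of_anarchy_le_iff:
  assumes "linear_congestion_game G" "0 \<le> \<rho>"
  shows "price_of_anarchy G \<Gamma> \<le> ereal \<rho> \<longleftrightarrow>
    (\<forall>S. pure_nash G \<Gamma> S \<longrightarrow> social_cost G S \<le> \<rho> * optimal_cost G)"
proof -
  have "ereal (social_cost G S) / ereal (optimal_cost G) \<le> ereal \<rho> \<longleftrightarrow>
      social_cost G S \<le> \<rho> * optimal_cost G" if "pure_nash G \<Gamma> S" for S
  proof (cases "optimal_cost G = 0")
    case True
    have "0 \<le> social_cost G S"
      using that assms social_cost_nonneg by (auto simp: pure_nash_def)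
    then show ?thesis
      using True assms by (cases "social_cost G S = 0") (auto simp: divide_ereal_def)
  next
    case False
    then have "0 < optimal_cost G"
      using optimal_cost_nonneg[OF assms(1)] by simp
    then show ?thesis
      by (simp add: pos_divide_le_eq)
  qed
  then show ?thesis
    unfolding price_of_anarchy_def SUP_le_iff by blast
qed

end

theory Submission
  imports Defs
begin

text \<open>Summing the equilibrium conditions for the deviations to an optimal profile gives a linear
  inequality between the congestions \<open>x\<close> and \<open>y\<close> of each resource in the two profiles. Multiplied by
  a suitable \<open>\<mu>\<close> and added to \<open>\<kappa>\<close> times the social cost, it reduces each bound to an inequality between
  natural numbers \<open>x\<close>, \<open>y\<close>. The multipliers \<open>\<mu> / \<kappa>\<close> are \<open>1 / (1 - a)\<close> and \<open>3 / (2 - a)\<close>, with \<open>a\<close> the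
  largest of the \<open>v i\<close>: the first makes the inequality tight at \<open>(x, y) = (1, 0)\<close> and \<open>(1, 1)\<close>, the
  second at \<open>(1, 1)\<close> and \<open>(2, 1)\<close>.\<close>

section \<open>Costs as sums over resources\<close>

lemma profile_subset_resources:
  assumes "linear_congestion_game G" "S \<in> profiles G" "i \<in> players G"
  shows "S i \<subseteq> resources G"
proof -
  have "S i \<in> strategies G i"
    using assms by (auto simp: profiles_def)
  then show ?thesis
    using assms by (auto simp: linear_congestion_game_def)
qed

lemma profile_update:
  assumes "S \<in> profiles G" "i \<in> players G" "t \<in> strategies G i"
  shows "S(i := t) \<in> profiles G"
  using assms unfolding profiles_def by (auto simp: PiE_iff extensional_def)

lemma congestion_eq_sum:
  "real (congestion G S e) = (\<Sum>j\<in>players G. of_bool (e \<in> S j))"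
proof -
  have "finite (players G)" by (simp add: players_def)
  then show ?thesis
    by (simp add: congestion_def of_bool_def sum.If_cases Int_def)
qed

lemma congestion_update:
  assumes "i \<in> players G"
  shows "real (congestion G (S(i := t)) e) =
    real (congestion G S e) - of_bool (e \<in> S i) + of_bool (e \<in> t)"
proof -
  have fin: "finite (players G)" by (simp add: players_def)
  have "(\<Sum>j\<in>players G - {i}. of_bool (e \<in> (S(i := t)) j)) =
      (\<Sum>j\<in>players G - {i}. of_bool (e \<in> S j) :: real)"
    by (intro sum.cong) auto
  then show ?thesis
    unfolding congestion_eq_sum sum.remove[OF fin assms] by simp
qed

lemma cost_eq_sum_resources:
  assumes "linear_congestion_game G" "S \<in> profiles G" "i \<in> players G"
  shows "cost G i S = (\<Sum>e\<in>resources G.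
    of_bool (e \<in> S i) * (slope G e * real (congestion G S e) + offset G e))"
proof -
  have "finite (resources G)" using assms by (simp add: linear_congestion_game_def)
  then show ?thesis
    unfolding cost_def using profile_subset_resources[OF assms]
    by (intro sum.mono_neutral_cong_left) auto
qed

text \<open>Exchanging the sums counts each resource once per user, which produces the squared
  congestion.\<close>

lemma social_cost_eq_sum_resources:
  assumes "linear_congestion_game G" "S \<in> profiles G"
  shows "social_cost G S = (\<Sum>e\<in>resources G.
    slope G e * (real (congestion G S e))\<^sup>2 + offset G e * real (congestion G S e))"
proof -
  have "social_cost G S = (\<Sum>i\<in>players G. \<Sum>e\<in>resources G.
      of_bool (e \<in> S i) * (slope G e * real (congestion G S e) + offset G e))"
    unfolding social_cost_def using assms by (intro sum.cong cost_eq_sum_resources) auto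
  also have "\<dots> = (\<Sum>e\<in>resources G. \<Sum>i\<in>players G.
      of_bool (e \<in> S i) * (slope G e * real (congestion G S e) + offset G e))"
    by (rule sum.swap)
  also have "\<dots> = (\<Sum>e\<in>resources G.
      real (congestion G S e) * (slope G e * real (congestion G S e) + offset G e))"
    by (simp add: sum_distrib_right congestion_eq_sum)
  finally show ?thesis by (simp add: power2_eq_square algebra_simps)
qed

text \<open>The social cost contains the player's own cost with weight \<open>v i\<close>, so the
  weight left over is \<open>1 - v i - v i\<close>.\<close>

lemma altruistic_cost_context_of:
  assumes "i \<in> players G"
  shows "altruistic_cost G (context_of v) i S = (1 - 2 * v i) * cost G i S + v i * social_cost G S"
proof -
  have fin: "finite (players G)" by (simp add: players_def)
  have "(\<Sum>j\<in>players G - {i}. context_of v i j * cost G j S) =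
      v i * (\<Sum>j\<in>players G - {i}. cost G j S)"
    unfolding sum_distrib_left by (intro sum.cong) (auto simp: context_of_def)
  then show ?thesis
    unfolding altruistic_cost_def social_cost_def sum.remove[OF fin assms]
    by (simp add: context_of_def algebra_simps)
qed

lemma altruistic_cost_eq_sum_resources:
  assumes "linear_congestion_game G" "S \<in> profiles G" "i \<in> players G"
  shows "altruistic_cost G (context_of v) i S = (\<Sum>e\<in>resources G.
    (1 - 2 * v i) * (of_bool (e \<in> S i) * (slope G e * real (congestion G S e) + offset G e)) +
    v i * (slope G e * (real (congestion G S e))\<^sup>2 + offset G e * real (congestion G S e)))"
  by (simp only: altruistic_cost_context_of[OF assms(3)] cost_eq_sum_resources[OF assms]
      social_cost_eq_sum_resources[OF assms(1,2)] sum_distrib_left sum.distrib distrib_left)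

section \<open>The inequality implied by equilibrium\<close>

text \<open>Resource by resource this is an equality, except where \<open>e\<close> lies in both
  \<open>S i\<close> and \<open>t\<close>: there nothing changes, while the right side gains
  \<open>slope G e\<close>. This slack makes the bound separate into a term for joining and a term
  for leaving.\<close>

lemma altruistic_cost_update_le:
  assumes G: "linear_congestion_game G" and S: "S \<in> profiles G"
    and i: "i \<in> players G" and t: "t \<in> strategies G i"
  shows "altruistic_cost G (context_of v) i (S(i := t)) - altruistic_cost G (context_of v) i S \<le>
    (\<Sum>e\<in>resources G.
      of_bool (e \<in> t) *
        (slope G e * (real (congestion G S e) + 1 - v i) + (1 - v i) * offset G e) -
      of_bool (e \<in> S i) *
        (slope G e * (real (congestion G S e) - v i) + (1 - v i) * offset G e))"
proof -
  have "0 \<le> slope G e" if "e \<in> resources G" for e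
    using G that by (simp add: linear_congestion_game_def)
  then show ?thesis
    unfolding altruistic_cost_eq_sum_resources[OF G profile_update[OF S i t] i]
      altruistic_cost_eq_sum_resources[OF G S i] sum_subtractf[symmetric]
    by (intro sum_mono)
      (auto simp: congestion_update[OF i] of_bool_def power2_eq_square algebra_simps)
qed

lemma pure_nash_sum_resources:
  assumes G: "linear_congestion_game G" and nash: "pure_nash G (context_of v) S"
    and T: "T \<in> profiles G"
    and v: "\<And>i. i \<in> players G \<Longrightarrow> b \<le> v i \<and> v i \<le> a"
  defines "x \<equiv> \<lambda>e. real (congestion G S e)" and "y \<equiv> \<lambda>e. real (congestion G T e)"
  shows "0 \<le> (\<Sum>e\<in>resources G.
    slope G e * (x e * y e + (1 - b) * y e - (x e)\<^sup>2 + a * x e) +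
    offset G e * ((1 - b) * y e - (1 - a) * x e))"
proof -
  have S: "S \<in> profiles G" using nash by (simp add: pure_nash_def)
  define p where "p i e = slope G e * (x e + 1 - v i) + (1 - v i) * offset G e" for i e
  define q where "q i e = slope G e * (x e - v i) + (1 - v i) * offset G e" for i e
  have "0 \<le> (\<Sum>i\<in>players G. \<Sum>e\<in>resources G.
      of_bool (e \<in> T i) * p i e - of_bool (e \<in> S i) * q i e)"
  proof (rule sum_nonneg)
    fix i assume i: "i \<in> players G"
    then have t: "T i \<in> strategies G i" using T by (auto simp: profiles_def)
    have "0 \<le> altruistic_cost G (context_of v) i (S(i := T i)) -
        altruistic_cost G (context_of v) i S"
      using nash i t by (simp add: pure_nash_def)
    also note altruistic_cost_update_le[OF G S i t]
    finally show "0 \<le> (\<Sum>e\<in>resources G.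
        of_bool (e \<in> T i) * p i e - of_bool (e \<in> S i) * q i e)"
      by (simp add: p_def q_def x_def)
  qed
  also have "\<dots> = (\<Sum>e\<in>resources G. \<Sum>i\<in>players G.
      of_bool (e \<in> T i) * p i e - of_bool (e \<in> S i) * q i e)"
    by (rule sum.swap)
  also have "\<dots> \<le> (\<Sum>e\<in>resources G.
      slope G e * (x e * y e + (1 - b) * y e - (x e)\<^sup>2 + a * x e) +
      offset G e * ((1 - b) * y e - (1 - a) * x e))"
  proof (rule sum_mono)
    fix e assume "e \<in> resources G"
    then have nonneg: "0 \<le> slope G e" "0 \<le> offset G e"
      using G by (auto simp: linear_congestion_game_def)
    define P where "P = slope G e * (x e + 1 - b) + (1 - b) * offset G e"
    define Q where "Q = slope G e * (x e - a) + (1 - a) * offset G e"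
    \<comment> \<open>Both \<open>p i e\<close> and \<open>q i e\<close> decrease in
      \<open>v i\<close>, so the upper bound takes \<open>b\<close> and the lower bound takes
      \<open>a\<close>.\<close>
    have "p i e \<le> P" "Q \<le> q i e" if "i \<in> players G" for i
      using v[OF that] nonneg unfolding p_def q_def P_def Q_def
      by (auto intro!: add_mono mult_left_mono mult_right_mono)
    then have "(\<Sum>i\<in>players G. of_bool (e \<in> T i) * p i e - of_bool (e \<in> S i) * q i e) \<le>
        (\<Sum>i\<in>players G. of_bool (e \<in> T i) * P - of_bool (e \<in> S i) * Q)"
      by (intro sum_mono diff_mono mult_left_mono) auto
    \<comment> \<open>\<open>P\<close> and \<open>Q\<close> do not depend on the player, so the
      indicators add up to the two congestions.\<close>
    also have "\<dots> = y e * P - x e * Q"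
      by (simp add: x_def y_def congestion_eq_sum sum_subtractf sum_distrib_right)
    also have "\<dots> = slope G e * (x e * y e + (1 - b) * y e - (x e)\<^sup>2 + a * x e) +
        offset G e * ((1 - b) * y e - (1 - a) * x e)"
      by (simp add: P_def Q_def power2_eq_square algebra_simps)
    finally show "(\<Sum>i\<in>players G. of_bool (e \<in> T i) * p i e - of_bool (e \<in> S i) * q i e) \<le>
      slope G e * (x e * y e + (1 - b) * y e - (x e)\<^sup>2 + a * x e) +
        offset G e * ((1 - b) * y e - (1 - a) * x e)" .
  qed
  finally show ?thesis .
qed

section \<open>From an inequality between congestions to the price of anarchy\<close>

text \<open>The two sides are compared on each resource. The offset part is linear in the
  congestions and needs only the two conditions relating \<open>\<mu>\<close> to
  \<open>\<kappa>\<close> and \<open>\<rho>\<close>; the slope part is quadratic and is exactly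
  \<open>smooth\<close>.\<close>

lemma pure_nash_social_cost_le:
  assumes G: "linear_congestion_game G" and nash: "pure_nash G (context_of v) S"
    and T: "T \<in> profiles G"
    and v: "\<And>i. i \<in> players G \<Longrightarrow> b \<le> v i \<and> v i \<le> a"
    and \<mu>: "0 \<le> \<mu>" "\<kappa> \<le> \<mu> * (1 - a)" "\<mu> * (1 - b) \<le> \<rho>"
    and smooth: "\<And>x y :: nat. \<kappa> * (real x)\<^sup>2 +
      \<mu> * (real x * real y + (1 - b) * real y - (real x)\<^sup>2 + a * real x) \<le> \<rho> * (real y)\<^sup>2"
  shows "\<kappa> * social_cost G S \<le> \<rho> * social_cost G T"
proof -
  have S: "S \<in> profiles G" using nash by (simp add: pure_nash_def)
  let ?x = "\<lambda>e. real (congestion G S e)" and ?y = "\<lambda>e. real (congestion G T e)"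
  let ?f = "\<lambda>e. ?x e * ?y e + (1 - b) * ?y e - (?x e)\<^sup>2 + a * ?x e"
  let ?g = "\<lambda>e. (1 - b) * ?y e - (1 - a) * ?x e"
  have "\<kappa> * social_cost G S \<le>
      \<kappa> * social_cost G S + \<mu> * (\<Sum>e\<in>resources G. slope G e * ?f e + offset G e * ?g e)"
    \<comment> \<open>The added sum is nonnegative because \<open>S\<close> is an
      equilibrium.\<close>
    using pure_nash_sum_resources[OF G nash T v] \<mu>(1) by simp
  also have "\<dots> = (\<Sum>e\<in>resources G. slope G e * (\<kappa> * (?x e)\<^sup>2 + \<mu> * ?f e) +
      offset G e * (\<kappa> * ?x e + \<mu> * ?g e))"
    unfolding social_cost_eq_sum_resources[OF G S] sum_distrib_left sum.distrib[symmetric]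
    by (intro sum.cong) (auto simp: algebra_simps)
  also have "\<dots> \<le> (\<Sum>e\<in>resources G. slope G e * (\<rho> * (?y e)\<^sup>2) + offset G e * (\<rho> * ?y e))"
  proof (intro sum_mono add_mono mult_left_mono smooth)
    fix e assume "e \<in> resources G"
    then show "0 \<le> slope G e" "0 \<le> offset G e"
      using G by (auto simp: linear_congestion_game_def)
    have "\<kappa> * ?x e \<le> \<mu> * (1 - a) * ?x e" "\<mu> * (1 - b) * ?y e \<le> \<rho> * ?y e"
      using \<mu> by (auto intro: mult_right_mono)
    then show "\<kappa> * ?x e + \<mu> * ?g e \<le> \<rho> * ?y e"
      by (simp add: algebra_simps)
  qed
  also have "\<dots> = \<rho> * social_cost G T"
    unfolding social_cost_eq_sum_resources[OF G T] sum_distrib_left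
    by (intro sum.cong) (auto simp: algebra_simps)
  finally show ?thesis .
qed

lemma price_of_anarchy_le_smooth:
  assumes G: "linear_congestion_game G"
    and v: "\<And>i. i \<in> players G \<Longrightarrow> b \<le> v i \<and> v i \<le> a"
    and pos: "0 < \<kappa>" "0 \<le> \<rho>"
    and \<mu>: "0 \<le> \<mu>" "\<kappa> \<le> \<mu> * (1 - a)" "\<mu> * (1 - b) \<le> \<rho>"
    and smooth: "\<And>x y :: nat. \<kappa> * (real x)\<^sup>2 +
      \<mu> * (real x * real y + (1 - b) * real y - (real x)\<^sup>2 + a * real x) \<le> \<rho> * (real y)\<^sup>2"
  shows "price_of_anarchy G (context_of v) \<le> ereal (\<rho> / \<kappa>)"
proof -
  have "optimal_cost G \<in> social_cost G ` profiles G"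
    unfolding optimal_cost_def using finite_profiles[OF G] profiles_nonempty[OF G]
    by (intro Min_in) auto
  then obtain T where T: "T \<in> profiles G" "optimal_cost G = social_cost G T"
    by blast
  have "social_cost G S \<le> \<rho> / \<kappa> * optimal_cost G" if "pure_nash G (context_of v) S" for S
    using pure_nash_social_cost_le[OF G that T(1) v \<mu> smooth] pos(1)
    by (simp add: T(2) field_simps)
  then show ?thesis
    using pos by (subst price_of_anarchy_le_iff[OF G]) auto
qed

section \<open>Inequalities between natural numbers\<close>

text \<open>Integrality enters here: the inequality fails for reals strictly between 0 and 1. It is
  used below for differences of congestions, which may be negative.\<close>

lemma int_le_square: "(z :: int) \<le> z\<^sup>2"
proof (cases "z \<le> 0")
  case True
  then show ?thesis using zero_le_power2[of z] by linarith
next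
  case False
  then show ?thesis by (simp add: self_le_power)
qed

lemma real_of_nat_le_square: "real y \<le> (real y)\<^sup>2"
  by (cases y) (auto simp: self_le_power)

lemma real_of_nat_diff_le_square: "real x - real y \<le> (real x - real y)\<^sup>2"
proof -
  have "real_of_int (int x - int y) \<le> real_of_int ((int x - int y)\<^sup>2)"
    by (simp only: of_int_le_iff int_le_square)
  then show ?thesis by simp
qed

text \<open>The right side minus the left side is
  \<open>(a - 1/2) * (x^2 - x) + (1 - b) * (y^2 - y)\<close> plus half of
  \<open>(x - y)^2 - (x - y)\<close> and half of \<open>y^2 - y\<close>.\<close>

lemma smooth_large_altruism:
  fixes a b :: real and x y :: nat
  assumes "1/2 \<le> a" "b \<le> 1"
  shows "(1 - a) * (real x)\<^sup>2 +
    1 * (real x * real y + (1 - b) * real y - (real x)\<^sup>2 + a * real x) \<le> (2 - b) * (real y)\<^sup>2"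
proof -
  have "0 \<le> (a - 1/2) * ((real x)\<^sup>2 - real x)" "0 \<le> (1 - b) * ((real y)\<^sup>2 - real y)"
    using assms real_of_nat_le_square by auto
  then show ?thesis
    using real_of_nat_diff_le_square[of x y] real_of_nat_le_square[of y]
    by (simp add: power2_eq_square algebra_simps)
qed

lemma smooth_small_altruism:
  fixes a b :: real and x y :: nat
  assumes "0 \<le> a" "a \<le> 1/2" "b \<le> 1/2"
  shows "(2 - a) * (real x)\<^sup>2 +
    3 * (real x * real y + (1 - b) * real y - (real x)\<^sup>2 + a * real x) \<le>
    (5 + 2 * a - 3 * b) * (real y)\<^sup>2"
proof -
  let ?x = "real x" and ?y = "real y"
  have b: "0 \<le> (1/2 - b) * (?y\<^sup>2 - ?y)"
    using assms real_of_nat_le_square by auto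
  \<comment> \<open>After replacing \<open>b\<close> by \<open>1/2\<close> the inequality is affine in \<open>a\<close>, so the end points suffice.\<close>
  have A0: "0 \<le> ?x\<^sup>2 - 3 * ?x * ?y + 7/2 * ?y\<^sup>2 - 3/2 * ?y"
  proof (cases "y \<le> 1")
    case True
    then consider "y = 0" | "y = 1" by linarith
    then show ?thesis
    proof cases
      case 1
      then show ?thesis by simp
    next
      case 2
      \<comment> \<open>For \<open>y = 1\<close> the expression is \<open>(x - 1) * (x - 2)\<close>,
        that is, \<open>z^2 - z\<close> with \<open>z = x - 1\<close>.\<close>
      then show ?thesis
        using real_of_nat_diff_le_square[of x 1] by (simp add: power2_eq_square algebra_simps)
    qed
  next
    case False
    \<comment> \<open>Completing the square in \<open>x\<close> leaves
      \<open>5/4 * y^2 - 3/2 * y\<close>, which is nonnegative from \<open>y = 2\<close> on but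
      negative at \<open>y = 1\<close>.\<close>
    then have "0 \<le> ?y * (5/4 * ?y - 3/2)" by simp
    moreover have "0 \<le> (?x - 3/2 * ?y)\<^sup>2" by simp
    ultimately show ?thesis by (simp add: power2_eq_square algebra_simps)
  qed
  \<comment> \<open>The expression equals
    \<open>3/2 * ((x - y)^2 - (x - y)) + 3 * (y^2 - y)\<close>.\<close>
  have A1: "0 \<le> 3/2 * ?x\<^sup>2 - 3 * ?x * ?y - 3/2 * ?x + 9/2 * ?y\<^sup>2 - 3/2 * ?y"
    using real_of_nat_diff_le_square[of x y] real_of_nat_le_square[of y]
    by (simp add: power2_eq_square algebra_simps)
  have "0 \<le> (1 - 2 * a) * (?x\<^sup>2 - 3 * ?x * ?y + 7/2 * ?y\<^sup>2 - 3/2 * ?y) +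
      2 * a * (3/2 * ?x\<^sup>2 - 3 * ?x * ?y - 3/2 * ?x + 9/2 * ?y\<^sup>2 - 3/2 * ?y)"
    using assms A0 A1 by (intro add_nonneg_nonneg mult_nonneg_nonneg) auto
  then show ?thesis
    using b by (simp add: power2_eq_square field_simps)
qed

theorem theorem11:
  fixes G :: "'e congestion_game" and n :: nat and v :: "nat \<Rightarrow> real" and vmax vmin :: real
  assumes "n \<ge> 2"
    and "\<forall>i\<in>{1..n}. v i \<in> {0..1}"
    and "vmax = Max (v ` {1..n})"
    and "vmin = Min (v ` {1..n})"
    and "linear_congestion_game G"
    and "num_players G = n"
  shows "(vmax \<in> {1/2..1} \<longrightarrow>
            price_of_anarchy G (context_of v) \<le> ereal (2 - vmin) / ereal (1 - vmax)) \<and>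
         (vmax \<in> {0..1/2} \<longrightarrow>
            price_of_anarchy G (context_of v) \<le> ereal ((5 + 2 * vmax - 3 * vmin) / (2 - vmax)))"
proof -
  have v: "vmin \<le> v i \<and> v i \<le> vmax" if "i \<in> players G" for i
    using that assms(3,4,6) by (auto simp: players_def)
  have one: "1 \<in> players G" using assms(1,6) by (simp add: players_def)
  have "v 1 \<le> 1" using assms(1,2) by simp
  then have vmin: "vmin \<le> vmax" "vmin \<le> 1"
    using v[OF one] by linarith+
  show ?thesis
  proof (intro conjI impI)
    assume vmax: "vmax \<in> {1/2..1}"
    show "price_of_anarchy G (context_of v) \<le> ereal (2 - vmin) / ereal (1 - vmax)"
    proof (cases "vmax = 1")
      case True
      \<comment> \<open>The numerator is positive since \<open>vmin\<close> is at most 1, so the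
        quotient by 0 is infinite.\<close>
      then show ?thesis using vmin by (simp add: divide_ereal_def)
    next
      case False
      then have "price_of_anarchy G (context_of v) \<le> ereal ((2 - vmin) / (1 - vmax))"
        using vmax vmin
        by (intro price_of_anarchy_le_smooth[where \<mu> = 1, OF assms(5) v]
            smooth_large_altruism) auto
      then show ?thesis using False by simp
    qed
  next
    assume "vmax \<in> {0..1/2}"
    \<comment> \<open>With \<open>\<mu> = 3\<close> and \<open>\<kappa> = 2 - vmax\<close>, the
      condition on the offsets \<open>\<kappa> \<le> \<mu> * (1 - vmax)\<close> says precisely that
      \<open>vmax\<close> is at most 1/2.\<close>
    then show "price_of_anarchy G (context_of v) \<le>
        ereal ((5 + 2 * vmax - 3 * vmin) / (2 - vmax))"
      using vmin
      by (intro price_of_anarchy_le_smooth[where \<mu> = 3, OF assms(5) v]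
          smooth_small_altruism) auto
  qed
qed

end
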